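(* Let $n\ge 1$. For every $[n]$-decorated binary tree $T$ of Shi type there exists a unique face $\Psi(T)$ of the Shi arrangement in $\mathbb{R}^n$ consisting of exactly the points $p=(p_1,\dots,p_n)\in\mathbb{R}^n$ satisfying: (1) for all $i,j\in[n]$, $p_i\le p_j$ if and only if $v_T(i)\preceq_T v_T(j)$; (2) for all $i<j$ in $[n]$, $p_i<p_j+1$ if and only if $v_T(i)\prec_T v^1_T(j)$; (3) for all $i<j$ in $[n]$, $p_i=p_j+1$ if and only if $v_T(i)=v^1_T(j)$ and $v^1_T(j)$ is a captive node. The map $T\mapsto\Psi(T)$ is a bijection from the set of $[n]$-decorated binary trees of Shi type to the set of faces of the Shi arrangement in $\mathbb{R}^n$. Moreover, such a $T$ has exactly $k$ free nodes if and only if $\Psi(T)$ has dimension $k$.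
   Context: $[n]=\{1,\dots,n\}$. A face of a finite arrangement of affine hyperplanes in $\mathbb{R}^n$ is a nonempty set obtained by choosing, for each hyperplane $\{a\cdot x=c\}$, one of $a\cdot x<c$, $=c$, $>c$ and taking the solution set; its dimension is that of its affine span. The Shi arrangement in $\mathbb{R}^n$ consists of the hyperplanes $x_i-x_j=0$ and $x_i-x_j=1$ for $1\le i<j\le n$. A binary tree is a rooted plane tree in which every vertex has 0 or 2 children; childless vertices are leaves, others nodes; the first child is the left child, the second the right child, with left and right edges. An internal edge joins two nodes. An $[n]$-decorated binary tree is a binary tree whose nodes are labeled by nonempty subsets of $[n]$ forming a set partition of $[n]$, with each right internal edge declared solid or dashed (all other edges solid). An internal edge is a descent if $\max A>\min B$, where $A$ is the label of the parent and $B$ that of the child; the tree is of Shi type if all its right internal edges are descents. A captive node is a node joined to its parent by a dashed edge; a free node is a node that is not captive. For a vertex $v$, $\rho(v)$ is the word in $\{E_0,E_1\}$ recording the path from the root to $v$ ($E_0$ left, $E_1$ right), $\dot\rho(v)$ the number of right edges on it. For distinct $v,w$: $v\prec_T w$ iff $\dot\rho(v)<\dot\rho(w)$, or $\dot\rho(v)=\dot\rho(w)$ and either $\rho(v)$ is a proper prefix of $\rho(w)$ or at the first differing position $\rho(v)$ has $E_1$ and $\rho(w)$ has $E_0$; $\preceq_T$ is $\prec_T$ or equality. $v_T(i)$ is the node whose label contains $i$, and $v^1_T(i)$ its right child. *)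

theory Defs
  imports "HOL-Analysis.Analysis" "HOL-Library.Sublist" "HOL-Library.Disjoint_Sets"
begin

text \<open>
  The index set \<open>[n]\<close> is rendered as a type \<open>'n :: {finite, linorder}\<close> with \<open>CARD('n) = n\<close>;
  only its linear order is used.  The ambient space is \<open>real ^ 'n\<close>.
\<close>

subsection \<open>Hyperplane arrangements\<close>

text \<open>The pair \<open>(a, c)\<close> stands for the hyperplane \<open>a \<bullet> x = c\<close>.\<close>

definition arrangement_faces :: "('v::euclidean_space \<times> real) set \<Rightarrow> 'v set set" where
  "arrangement_faces H = {F. F \<noteq> {} \<and>
     (\<exists>\<sigma>. (\<forall>h\<in>H. \<sigma> h \<in> {(<), (=), (>)}) \<and>
          F = {x. \<forall>(a, c)\<in>H. \<sigma> (a, c) (a \<bullet> x) c})}"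

definition shi_arrangement :: "((real, 'n::{finite,linorder}) vec \<times> real) set" where
  "shi_arrangement = {(axis i 1 - axis j 1, c) | i j c. i < j \<and> c \<in> {0, 1}}"

subsection \<open>Decorated binary trees\<close>

text \<open>
  \<open>Node A L d R\<close> is a node with label \<open>A\<close>, left subtree \<open>L\<close> and right subtree \<open>R\<close>; the
  flag \<open>d\<close> says that the edge to the right child is dashed.  Only internal edges can be dashed,
  so \<open>decorated\<close> below requires \<open>d = False\<close> if \<open>R = Leaf\<close>.
\<close>

datatype 'a dtree = Leaf | Node "'a set" "'a dtree" bool "'a dtree"

datatype step = E0 | E1

text \<open>A vertex \<open>v\<close> is identified with the word \<open>\<rho>(v)\<close> of the path from the root to it.\<close>

fun nodes :: "'a dtree \<Rightarrow> step list set" where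
  "nodes Leaf = {}"
| "nodes (Node A L d R) = {[]} \<union> (#) E0 ` nodes L \<union> (#) E1 ` nodes R"

fun node_label :: "'a dtree \<Rightarrow> step list \<Rightarrow> 'a set" where
  "node_label Leaf v = {}"
| "node_label (Node A L d R) [] = A"
| "node_label (Node A L d R) (E0 # v) = node_label L v"
| "node_label (Node A L d R) (E1 # v) = node_label R v"

text \<open>\<open>right_dashed T v\<close>: the edge from the node \<open>v\<close> to its right child is dashed.\<close>

fun right_dashed :: "'a dtree \<Rightarrow> step list \<Rightarrow> bool" where
  "right_dashed Leaf v = False"
| "right_dashed (Node A L d R) [] = d"
| "right_dashed (Node A L d R) (E0 # v) = right_dashed L v"
| "right_dashed (Node A L d R) (E1 # v) = right_dashed R v"

definition left_child :: "step list \<Rightarrow> step list" where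
  "left_child v = v @ [E0]"

definition right_child :: "step list \<Rightarrow> step list" where
  "right_child v = v @ [E1]"

definition decorated :: "'a dtree \<Rightarrow> bool" where
  "decorated T \<longleftrightarrow>
     inj_on (node_label T) (nodes T) \<and>
     partition_on UNIV (node_label T ` nodes T) \<and>
     (\<forall>v\<in>nodes T. right_dashed T v \<longrightarrow> right_child v \<in> nodes T)"

definition internal_edge :: "'a dtree \<Rightarrow> step list \<Rightarrow> step list \<Rightarrow> bool" where
  "internal_edge T v w \<longleftrightarrow>
     v \<in> nodes T \<and> w \<in> nodes T \<and> (w = left_child v \<or> w = right_child v)"

definition descent :: "'a::linorder dtree \<Rightarrow> step list \<Rightarrow> step list \<Rightarrow> bool" where
  "descent T v w \<longleftrightarrow> internal_edge T v w \<and> Max (node_label T v) > Min (node_label T w)"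

definition shi_type :: "'a::linorder dtree \<Rightarrow> bool" where
  "shi_type T \<longleftrightarrow> (\<forall>v. internal_edge T v (right_child v) \<longrightarrow> descent T v (right_child v))"

definition shi_trees :: "'n::{finite,linorder} dtree set" where
  "shi_trees = {T. decorated T \<and> shi_type T}"

definition captive :: "'a dtree \<Rightarrow> step list \<Rightarrow> bool" where
  "captive T w \<longleftrightarrow> w \<in> nodes T \<and> (\<exists>v\<in>nodes T. w = right_child v \<and> right_dashed T v)"

definition free_nodes :: "'a dtree \<Rightarrow> step list set" where
  "free_nodes T = {v \<in> nodes T. \<not> captive T v}"

subsection \<open>The order on vertices\<close>

text \<open>Since vertices are words, the order does not depend on the tree.\<close>

definition rho_dot :: "step list \<Rightarrow> nat" where
  "rho_dot v = count_list v E1"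

definition vertex_less :: "step list \<Rightarrow> step list \<Rightarrow> bool" (infix "\<prec>\<^sub>T" 50) where
  "v \<prec>\<^sub>T w \<longleftrightarrow> v \<noteq> w \<and>
     (rho_dot v < rho_dot w \<or>
      rho_dot v = rho_dot w \<and>
        (strict_prefix v w \<or> (\<exists>u v' w'. v = u @ E1 # v' \<and> w = u @ E0 # w')))"

definition vertex_le :: "step list \<Rightarrow> step list \<Rightarrow> bool" (infix "\<preceq>\<^sub>T" 50) where
  "v \<preceq>\<^sub>T w \<longleftrightarrow> v \<prec>\<^sub>T w \<or> v = w"

definition node_of :: "'a dtree \<Rightarrow> 'a \<Rightarrow> step list" where
  "node_of T i = (THE v. v \<in> nodes T \<and> i \<in> node_label T v)"

subsection \<open>The face of a tree\<close>

definition face_conditions :: "'n::{finite,linorder} dtree \<Rightarrow> (real, 'n) vec \<Rightarrow> bool" where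
  "face_conditions T p \<longleftrightarrow>
     (\<forall>i j. p $ i \<le> p $ j \<longleftrightarrow> node_of T i \<preceq>\<^sub>T node_of T j) \<and>
     (\<forall>i j. i < j \<longrightarrow> (p $ i < p $ j + 1 \<longleftrightarrow> node_of T i \<prec>\<^sub>T right_child (node_of T j))) \<and>
     (\<forall>i j. i < j \<longrightarrow> (p $ i = p $ j + 1 \<longleftrightarrow>
        node_of T i = right_child (node_of T j) \<and> captive T (right_child (node_of T j))))"

definition Psi :: "'n::{finite,linorder} dtree \<Rightarrow> (real, 'n) vec set" where
  "Psi T = (THE F. F \<in> arrangement_faces shi_arrangement \<and> (\<forall>p. p \<in> F \<longleftrightarrow> face_conditions T p))"

end

theory Submission
  imports Defs "HOL-Library.List_Lexorder"
begin

text \<open>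
  Order words lexicographically with prefixes first and \<open>E1\<close> before \<open>E0\<close>.  The right child of a
  vertex is then its immediate successor in the lexicographic order, and the left child is its
  immediate successor in the order \<open>\<prec>\<^sub>T\<close>.

  Let \<open>r(v)\<close> be the number of free nodes that do not come after \<open>v\<close> in the lexicographic order.  It
  does not change along a dashed edge, and two nodes with the same value of \<open>r\<close> are joined by a path
  of dashed edges.  So the number of right edges above \<open>v\<close> as integer part and \<open>r(v)\<close>, scaled down,
  as fractional part give the coordinates of a point in the face of \<open>T\<close>.  The directions of the
  affine span of the face are the vectors whose coordinates depend on \<open>r\<close> only: since right edges
  are descents, each dashed edge comes with a hyperplane \<open>x\<^sub>i - x\<^sub>j = 1\<close> of the arrangement.

  Conversely, the tree is read off from a point \<open>p\<close> of its face by a greedy rule.  The vertex of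
  \<open>i\<close> is the largest vertex among the root, the left children of the vertices of all \<open>j\<close> with
  \<open>p\<^sub>j < p\<^sub>i\<close>, and the right children of the vertices of all \<open>j\<close> such that \<open>p\<^sub>j + 1 \<le> p\<^sub>i\<close> and
  \<open>p\<^sub>a = p\<^sub>i\<close>, \<open>p\<^sub>b = p\<^sub>j\<close> for some \<open>a < b\<close>.  For an arbitrary \<open>p\<close> the same rule defines a tree whose
  face contains \<open>p\<close>.
\<close>

section \<open>The order on vertices\<close>

instantiation step :: linorder
begin

definition less_step :: "step \<Rightarrow> step \<Rightarrow> bool" where
  "s < t \<longleftrightarrow> s = E1 \<and> t = E0"

definition less_eq_step :: "step \<Rightarrow> step \<Rightarrow> bool" where
  "s \<le> t \<longleftrightarrow> s = E1 \<or> t = E0"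

instance
  by standard (auto simp: less_step_def less_eq_step_def intro: step.exhaust)

end

lemma list_less_iff:
  "v < w \<longleftrightarrow> strict_prefix v w \<or> (\<exists>u a b v' w'. a < b \<and> v = u @ a # v' \<and> w = u @ b # w')"
  for v w :: "'a::order list"
proof -
  have "strict_prefix v w \<longleftrightarrow> (\<exists>a u. w = v @ a # u)"
    by (metis strict_prefixI' strict_prefixE')
  then show ?thesis
    unfolding list_less_def lexord_def by blast
qed

lemma vertex_less_iff:
  "v \<prec>\<^sub>T w \<longleftrightarrow> rho_dot v < rho_dot w \<or> rho_dot v = rho_dot w \<and> v < w"
proof -
  have "v < w \<longleftrightarrow> strict_prefix v w \<or> (\<exists>u v' w'. v = u @ E1 # v' \<and> w = u @ E0 # w')"
    unfolding list_less_iff by (auto simp: less_step_def)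
  then show ?thesis
    unfolding vertex_less_def by auto
qed

interpretation vertex: linorder "(\<preceq>\<^sub>T)" "(\<prec>\<^sub>T)"
  by standard (auto simp: vertex_le_def vertex_less_iff)

lemma not_vertex_less_Nil [simp]: "\<not> v \<prec>\<^sub>T []"
  by (simp add: vertex_less_iff rho_dot_def)

lemma Nil_vertex_le [simp]: "[] \<preceq>\<^sub>T v"
  by (simp add: vertex.not_less[symmetric])

lemma right_child_inject [simp]: "right_child u = right_child v \<longleftrightarrow> u = v"
  and left_child_neq_right_child [simp]:
    "left_child u \<noteq> right_child v" "right_child v \<noteq> left_child u"
  and right_child_neq_Nil [simp]: "right_child u \<noteq> []" "[] \<noteq> right_child u"
  by (auto simp: left_child_def right_child_def)

lemma rho_dot_left_child [simp]: "rho_dot (left_child v) = rho_dot v"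
  and rho_dot_right_child [simp]: "rho_dot (right_child v) = Suc (rho_dot v)"
  and rho_dot_right_child_funpow [simp]: "rho_dot ((right_child ^^ k) v) = rho_dot v + k"
  by (induction k) (simp_all add: rho_dot_def left_child_def right_child_def)

lemma vertex_cases [case_names Nil left_child right_child]:
  obtains "v = []" | u where "v = left_child u" | u where "v = right_child u"
proof (cases v rule: rev_cases)
  case (snoc u s)
  then show ?thesis using that(2,3) by (cases s) (auto simp: left_child_def right_child_def)
qed (use that(1) in simp)

lemma less_left_child_iff: "v < left_child u \<longleftrightarrow> v \<le> u \<or> (\<exists>w. v = u @ E1 # w)"
  unfolding left_child_def
proof (induction u arbitrary: v)
  case Nil
  then show ?case by (cases v) (auto simp: less_step_def)
next
  case (Cons s u)
  then show ?case by (cases v) auto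
qed

lemma less_right_child_iff [simp]: "v < right_child u \<longleftrightarrow> v \<le> u"
  unfolding right_child_def
proof (induction u arbitrary: v)
  case Nil
  then show ?case by (cases v) (auto simp: less_step_def)
next
  case (Cons s u)
  then show ?case by (cases v) auto
qed

lemma vertex_less_left_child_iff [simp]: "v \<prec>\<^sub>T left_child u \<longleftrightarrow> v \<preceq>\<^sub>T u"
  unfolding vertex_le_def vertex_less_iff
  by (auto simp: less_left_child_iff) (simp_all add: rho_dot_def)

lemma left_child_vertex_le_iff [simp]: "left_child u \<preceq>\<^sub>T v \<longleftrightarrow> u \<prec>\<^sub>T v"
  by (simp add: vertex.not_less[symmetric])

lemma vertex_less_right_child [simp]: "v \<prec>\<^sub>T right_child v"
  by (simp add: vertex_less_iff)

lemma right_child_le_iff [simp]: "right_child u \<le> v \<longleftrightarrow> u < v"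
  by (simp add: not_less[symmetric])

lemma right_child_vertex_less_iff [simp]: "right_child u \<prec>\<^sub>T right_child v \<longleftrightarrow> u \<prec>\<^sub>T v"
  by (simp add: vertex_less_iff)

lemma right_child_funpow_le: "v \<le> (right_child ^^ k) v"
proof (induction k)
  case (Suc k)
  then have "v < (right_child ^^ Suc k) v" by simp
  then show ?case by (rule less_imp_le)
qed simp

lemma less_right_child_funpowD:
  "w < (right_child ^^ k) v \<Longrightarrow> w \<le> v \<or> (\<exists>j<k. w = (right_child ^^ j) v)"
proof (induction k)
  case (Suc k)
  then have "w < (right_child ^^ k) v \<or> w = (right_child ^^ k) v"
    by auto
  with Suc.IH show ?case
    using less_SucI by blast
qed simp

section \<open>Trees as sets of words\<close>

lemma finite_nodes: "finite (nodes T)"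
  by (induction T) auto

lemma nodes_snocD: "v @ [s] \<in> nodes T \<Longrightarrow> v \<in> nodes T"
proof (induction T arbitrary: v)
  case (Node A L d R)
  then show ?case by (cases v) auto
qed simp

lemma nodes_left_childD: "left_child v \<in> nodes T \<Longrightarrow> v \<in> nodes T"
  and nodes_right_childD: "right_child v \<in> nodes T \<Longrightarrow> v \<in> nodes T"
  by (auto simp: left_child_def right_child_def dest: nodes_snocD)

lemma dtree_eqI:
  assumes "nodes T = nodes T'"
    and "\<And>v. v \<in> nodes T \<Longrightarrow> node_label T v = node_label T' v"
    and "\<And>v. v \<in> nodes T \<Longrightarrow> right_dashed T v = right_dashed T' v"
  shows "T = T'"
  using assms
proof (induction T arbitrary: T')
  case Leaf
  then show ?case by (cases T') auto
next
  case (Node A L d R)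
  then obtain A' L' d' R' where T': "T' = Node A' L' d' R'"
    by (cases T') auto
  note same_nodes = Node.prems(1)[unfolded T', THEN eqset_imp_iff]
    and same_label = Node.prems(2)[unfolded T']
    and same_dashed = Node.prems(3)[unfolded T']
  have "L = L'"
  proof (rule Node.IH(1))
    show "nodes L = nodes L'"
      using same_nodes[of "E0 # _"] by (simp add: set_eq_iff image_iff)
    fix v assume "v \<in> nodes L"
    then show "node_label L v = node_label L' v" "right_dashed L v = right_dashed L' v"
      using same_label[of "E0 # v"] same_dashed[of "E0 # v"] by auto
  qed
  moreover have "R = R'"
  proof (rule Node.IH(2))
    show "nodes R = nodes R'"
      using same_nodes[of "E1 # _"] by (simp add: set_eq_iff image_iff)
    fix v assume "v \<in> nodes R"
    then show "node_label R v = node_label R' v" "right_dashed R v = right_dashed R' v"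
      using same_label[of "E1 # v"] same_dashed[of "E1 # v"] by auto
  qed
  ultimately show ?case
    using T' same_label[of "[]"] same_dashed[of "[]"] by auto
qed

lemma dtree_with_nodes_of_bounded_length:
  assumes "\<And>v. v \<in> W \<Longrightarrow> length v < m" and "\<And>v s. v @ [s] \<in> W \<Longrightarrow> v \<in> W"
  shows "\<exists>T. nodes T = W \<and> (\<forall>v\<in>W. node_label T v = lab v \<and> (right_dashed T v \<longleftrightarrow> dashed v))"
  using assms
proof (induction m arbitrary: W lab dashed)
  case 0
  then show ?case
    by (intro exI[of _ Leaf]) auto
next
  case (Suc m)
  show ?case
  proof (cases "W = {}")
    case True
    then show ?thesis by (intro exI[of _ Leaf]) auto
  next
    case False
    then obtain v where "v \<in> W" by blast
    then have Nil: "[] \<in> W"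
      by (induction v rule: rev_induct) (auto dest: Suc.prems(2))
    have "\<exists>T. nodes T = {v. s # v \<in> W} \<and> (\<forall>v\<in>{v. s # v \<in> W}.
        node_label T v = lab (s # v) \<and> (right_dashed T v \<longleftrightarrow> dashed (s # v)))" for s
      using Suc.prems(1)[of "s # _"] Suc.prems(2)[of "s # _"] by (intro Suc.IH) auto
    then obtain subtree where
      subtree: "nodes (subtree s) = {v. s # v \<in> W}"
        "s # v \<in> W \<Longrightarrow> node_label (subtree s) v = lab (s # v)"
        "s # v \<in> W \<Longrightarrow> right_dashed (subtree s) v \<longleftrightarrow> dashed (s # v)" for s v
      unfolding mem_Collect_eq Ball_def by metis
    let ?T = "Node (lab []) (subtree E0) (dashed []) (subtree E1)"
    have "(v \<in> nodes ?T \<longleftrightarrow> v \<in> W) \<and>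
        (v \<in> W \<longrightarrow> node_label ?T v = lab v \<and> (right_dashed ?T v \<longleftrightarrow> dashed v))" for v
    proof (cases v)
      case (Cons s u)
      then show ?thesis using subtree by (cases s) auto
    qed (use Nil in simp)
    then show ?thesis by (intro exI[of _ ?T]) blast
  qed
qed

lemma dtree_with_nodes:
  assumes "finite W" and "\<And>v s. v @ [s] \<in> W \<Longrightarrow> v \<in> W"
  obtains T where "nodes T = W" "\<And>v. v \<in> W \<Longrightarrow> node_label T v = lab v"
    "\<And>v. v \<in> W \<Longrightarrow> right_dashed T v \<longleftrightarrow> dashed v"
proof -
  have "\<forall>v\<in>W. length v < Suc (Max (length ` W))"
    using assms(1) by (auto simp: less_Suc_eq_le)
  then show thesis
    using dtree_with_nodes_of_bounded_length[of W _ lab dashed] assms(2) that by blast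
qed

section \<open>Decorated trees\<close>

lemma decorated_ex1_node:
  assumes "decorated T" shows "\<exists>!v. v \<in> nodes T \<and> i \<in> node_label T v"
proof -
  have part: "partition_on UNIV (node_label T ` nodes T)"
    and inj: "inj_on (node_label T) (nodes T)"
    using assms by (auto simp: decorated_def)
  have "i \<in> \<Union> (node_label T ` nodes T)"
    using part by (simp add: partition_on_def)
  then obtain v where v: "v \<in> nodes T" "i \<in> node_label T v"
    by blast
  have "w = v" if "w \<in> nodes T" "i \<in> node_label T w" for w
  proof -
    have "node_label T v = node_label T w"
      using part v that unfolding partition_on_def disjoint_def by blast
    with inj v that show ?thesis by (auto dest: inj_onD)
  qed
  with v show ?thesis by blast
qed

lemma
  assumes "decorated T"
  shows node_of_in_nodes: "node_of T i \<in> nodes T"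
    and in_node_label_node_of: "i \<in> node_label T (node_of T i)"
  using theI'[OF decorated_ex1_node[OF assms]] unfolding node_of_def by auto

lemma node_of_eq_iff:
  assumes "decorated T" "v \<in> nodes T"
  shows "node_of T i = v \<longleftrightarrow> i \<in> node_label T v"
  using assms in_node_label_node_of the1_equality[OF decorated_ex1_node[OF assms(1)]]
  unfolding node_of_def by metis

lemma node_label_eq: "decorated T \<Longrightarrow> v \<in> nodes T \<Longrightarrow> node_label T v = {i. node_of T i = v}"
  by (simp add: node_of_eq_iff)

lemma node_label_nonempty: "decorated T \<Longrightarrow> v \<in> nodes T \<Longrightarrow> node_label T v \<noteq> {}"
  by (auto simp: decorated_def partition_on_def)

lemma nodes_eq_range_node_of:
  assumes "decorated T" shows "nodes T = range (node_of T)"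
proof (intro set_eqI iffI)
  fix v assume "v \<in> nodes T"
  with assms node_label_nonempty[OF assms this] show "v \<in> range (node_of T)"
    by (auto simp: node_label_eq)
qed (auto simp: node_of_in_nodes assms)

lemma right_dashed_iff_captive:
  assumes "decorated T" "v \<in> nodes T"
  shows "right_dashed T v \<longleftrightarrow> captive T (right_child v)"
  using assms by (auto simp: decorated_def captive_def)

lemma decorated_eqI:
  assumes "decorated T" "decorated T'" "node_of T = node_of T'"
    and "\<And>v. right_child v \<in> nodes T \<Longrightarrow> captive T (right_child v) \<longleftrightarrow> captive T' (right_child v)"
  shows "T = T'"
proof (rule dtree_eqI)
  show nodes: "nodes T = nodes T'"
    using assms by (simp add: nodes_eq_range_node_of)
  fix v assume v: "v \<in> nodes T"
  then show "node_label T v = node_label T' v"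
    using assms nodes by (simp add: node_label_eq)
  have "captive T (right_child v) \<longleftrightarrow> captive T' (right_child v)"
    using assms(4) nodes by (auto simp: captive_def)
  then show "right_dashed T v = right_dashed T' v"
    using assms(1,2) v nodes by (simp add: right_dashed_iff_captive)
qed

lemma decorated_exists:
  fixes w :: "'a::finite \<Rightarrow> step list"
  assumes "\<And>v s. v @ [s] \<in> range w \<Longrightarrow> v \<in> range w"
    and "C \<subseteq> range w \<inter> range right_child"
  obtains T where "decorated T" "node_of T = w" "\<And>v. captive T v \<longleftrightarrow> v \<in> C"
proof -
  obtain T where nodes: "nodes T = range w"
    and label: "\<And>v. v \<in> range w \<Longrightarrow> node_label T v = w -` {v}"
    and dashed: "\<And>v. v \<in> range w \<Longrightarrow> right_dashed T v \<longleftrightarrow> right_child v \<in> C"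
    by (rule dtree_with_nodes[of "range w" "\<lambda>v. w -` {v}" "\<lambda>v. right_child v \<in> C"])
      (use assms(1) in \<open>auto simp del: vimage_singleton_eq\<close>)
  have "decorated T"
    unfolding decorated_def
  proof (intro conjI ballI impI)
    show "inj_on (node_label T) (nodes T)"
      by (rule inj_onI) (auto simp: nodes label)
    show "partition_on UNIV (node_label T ` nodes T)"
      by (rule partition_onI) (auto simp: nodes label disjnt_def)
    show "right_child v \<in> nodes T" if "v \<in> nodes T" "right_dashed T v" for v
      using that dashed assms(2) by (auto simp: nodes)
  qed
  moreover from this have "node_of T = w"
    by (intro ext) (simp add: node_of_eq_iff nodes label)
  moreover have "captive T v \<longleftrightarrow> v \<in> C" for v
  proof
    show "v \<in> C" if "captive T v"
      using that by (auto simp: captive_def nodes dashed)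
    assume "v \<in> C"
    with assms(2) have v: "v \<in> nodes T" "v \<in> range right_child"
      unfolding nodes by blast+
    then obtain u where u: "v = right_child u" by blast
    with v have "u \<in> nodes T" using nodes_right_childD by simp
    with u v \<open>v \<in> C\<close> show "captive T v"
      by (auto simp: captive_def nodes dashed)
  qed
  ultimately show thesis by (rule that)
qed

lemma shi_type_iff:
  fixes T :: "'n::{finite,linorder} dtree"
  assumes "decorated T"
  shows "shi_type T \<longleftrightarrow> (\<forall>v. right_child v \<in> nodes T \<longrightarrow>
    (\<exists>i j. i < j \<and> node_of T i = right_child v \<and> node_of T j = v))"
proof -
  have "Min B < Max A \<longleftrightarrow> (\<exists>i\<in>B. \<exists>j\<in>A. i < j)" if "A \<noteq> {}" "B \<noteq> {}" for A B :: "'n set"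
    using that by (auto simp: Min_less_iff Max_gr_iff)
  then have "descent T v (right_child v) \<longleftrightarrow>
      (\<exists>i j. i < j \<and> node_of T i = right_child v \<and> node_of T j = v)"
    if "right_child v \<in> nodes T" for v
    using that assms nodes_right_childD[OF that] node_label_nonempty[OF assms]
    by (simp add: descent_def internal_edge_def node_of_eq_iff) metis
  moreover have "internal_edge T v (right_child v) \<longleftrightarrow> right_child v \<in> nodes T" for v
    using nodes_right_childD[of v T] by (auto simp: internal_edge_def)
  ultimately show ?thesis
    by (simp add: shi_type_def)
qed

section \<open>Faces of an arrangement\<close>

definition sign_cell :: "('v::euclidean_space \<times> real) set \<Rightarrow> 'v \<Rightarrow> 'v set" where
  "sign_cell H p = {x. \<forall>(a, c)\<in>H. sgn (a \<bullet> x - c) = sgn (a \<bullet> p - c)}"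

definition flat_directions :: "('v::euclidean_space \<times> real) set \<Rightarrow> 'v \<Rightarrow> 'v set" where
  "flat_directions H p = {x. \<forall>(a, c)\<in>H. a \<bullet> p = c \<longrightarrow> a \<bullet> x = 0}"

lemma self_mem_sign_cell [simp]: "p \<in> sign_cell H p"
  by (auto simp: sign_cell_def)

lemma arrangement_faces_eq_sign_cells: "arrangement_faces H = range (sign_cell H)"
proof (intro set_eqI iffI)
  fix F assume "F \<in> arrangement_faces H"
  then obtain \<sigma> p where \<sigma>: "\<forall>h\<in>H. \<sigma> h \<in> {(<), (=), (>)}"
    and F: "F = {x. \<forall>(a, c)\<in>H. \<sigma> (a, c) (a \<bullet> x) c}" and p: "p \<in> F"
    unfolding arrangement_faces_def by blast
  have "\<sigma> (a, c) (a \<bullet> x) c \<longleftrightarrow> sgn (a \<bullet> x - c) = sgn (a \<bullet> p - c)" if "(a, c) \<in> H" for a c x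
  proof -
    have "\<sigma> (a, c) (a \<bullet> p) c" using p F that by blast
    moreover have "\<sigma> (a, c) \<in> {(<), (=), (>)}" using \<sigma> that by blast
    ultimately show ?thesis by (auto simp: sgn_if)
  qed
  then have "F = sign_cell H p"
    unfolding F sign_cell_def by blast
  then show "F \<in> range (sign_cell H)" by blast
next
  fix F assume "F \<in> range (sign_cell H)"
  then obtain p where F: "F = sign_cell H p" by blast
  define \<sigma> :: "'a \<times> real \<Rightarrow> real \<Rightarrow> real \<Rightarrow> bool" where
    "\<sigma> h = (if fst h \<bullet> p < snd h then (<) else if fst h \<bullet> p = snd h then (=) else (>))" for h
  have "\<sigma> (a, c) (a \<bullet> x) c \<longleftrightarrow> sgn (a \<bullet> x - c) = sgn (a \<bullet> p - c)" for a c x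
    by (auto simp: \<sigma>_def sgn_if)
  then have "F = {x. \<forall>(a, c)\<in>H. \<sigma> (a, c) (a \<bullet> x) c}"
    unfolding F sign_cell_def by simp
  moreover have "F \<noteq> {}"
    using F self_mem_sign_cell by blast
  moreover have "\<forall>h\<in>H. \<sigma> h \<in> {(<), (=), (>)}"
    by (auto simp: \<sigma>_def)
  ultimately show "F \<in> arrangement_faces H"
    unfolding arrangement_faces_def by blast
qed

lemma subspace_flat_directions: "subspace (flat_directions H p)"
  by (rule subspaceI) (fastforce simp: flat_directions_def inner_add_right)+

lemma open_same_strict_sign:
  fixes a p :: "'v::euclidean_space"
  assumes "a \<bullet> p \<noteq> c"
  shows "open {x. sgn (a \<bullet> x - c) = sgn (a \<bullet> p - c)}"
proof (cases "a \<bullet> p < c")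
  case True
  then have "{x. sgn (a \<bullet> x - c) = sgn (a \<bullet> p - c)} = {x. a \<bullet> x < c}"
    by (auto simp: sgn_if)
  then show ?thesis by (simp add: open_halfspace_lt)
next
  case False
  with assms have "{x. sgn (a \<bullet> x - c) = sgn (a \<bullet> p - c)} = {x. a \<bullet> x > c}"
    by (auto simp: sgn_if)
  then show ?thesis by (simp add: open_halfspace_gt)
qed

text \<open>Near \<open>p\<close>, only the hyperplanes through \<open>p\<close> constrain the cell.\<close>

lemma aff_dim_sign_cell:
  assumes "finite H"
  shows "aff_dim (sign_cell H p) = int (dim (flat_directions H p))"
proof -
  define flat where "flat = (+) p ` flat_directions H p"
  define U where "U = (\<Inter>(a, c)\<in>{(a, c)\<in>H. a \<bullet> p \<noteq> c}. {x. sgn (a \<bullet> x - c) = sgn (a \<bullet> p - c)})"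
  have "finite {(a, c)\<in>H. a \<bullet> p \<noteq> c}"
    by (rule finite_subset[OF _ assms]) auto
  then have "open U"
    unfolding U_def by (rule open_INT) (auto simp: open_same_strict_sign)
  have "q \<in> flat \<longleftrightarrow> q - p \<in> flat_directions H p" for q
    unfolding flat_def by force
  then have "q \<in> sign_cell H p \<longleftrightarrow> q \<in> flat \<inter> U" for q
    by (fastforce simp: sign_cell_def flat_directions_def U_def inner_diff_right sgn_0_0)
  then have cell: "sign_cell H p = flat \<inter> U" by blast
  have "affine flat"
    using subspace_imp_affine[OF subspace_flat_directions]
    by (simp add: flat_def affine_translation[symmetric])
  then have "affine hull (sign_cell H p) = affine hull flat"
    using \<open>open U\<close> self_mem_sign_cell[of p H] unfolding cell
    by (intro affine_hull_affine_Int_open) auto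
  then have "aff_dim (sign_cell H p) = aff_dim flat"
    by (metis aff_dim_affine_hull)
  also have "\<dots> = int (dim (flat_directions H p))"
    by (simp add: flat_def aff_dim_translation_eq aff_dim_subspace subspace_flat_directions)
  finally show ?thesis .
qed

section \<open>The Shi arrangement\<close>

lemma finite_shi_arrangement: "finite shi_arrangement"
proof (rule finite_subset)
  show "shi_arrangement \<subseteq> (\<lambda>(i, j, c). (axis i 1 - axis j 1, c)) ` (UNIV \<times> UNIV \<times> {0, 1})"
    unfolding shi_arrangement_def by force
qed simp

lemma ball_shi_arrangement:
  "(\<forall>(a, c)\<in>shi_arrangement. P a c) \<longleftrightarrow>
    (\<forall>i j. i < j \<longrightarrow> P (axis i 1 - axis j 1) 0 \<and> P (axis i 1 - axis j 1) 1)"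
  unfolding shi_arrangement_def by blast

lemma inner_axis_diff: "(axis i 1 - axis j 1) \<bullet> x = x $ i - x $ j" for x :: "real ^ 'n"
  by (simp add: inner_diff_left inner_axis')

lemma mem_flat_directions_shi_iff:
  "x \<in> flat_directions shi_arrangement p \<longleftrightarrow>
    (\<forall>i j. i < j \<longrightarrow> p $ i = p $ j \<or> p $ i = p $ j + 1 \<longrightarrow> x $ i = x $ j)"
  unfolding flat_directions_def mem_Collect_eq ball_shi_arrangement inner_axis_diff
  by (auto simp: algebra_simps)

lemma mem_shi_cell_iff:
  "q \<in> sign_cell shi_arrangement p \<longleftrightarrow> (\<forall>i j. q $ i \<le> q $ j \<longleftrightarrow> p $ i \<le> p $ j) \<and>
     (\<forall>i j. i < j \<longrightarrow> (q $ i < q $ j + 1 \<longleftrightarrow> p $ i < p $ j + 1)) \<and>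
     (\<forall>i j. i < j \<longrightarrow> (q $ i = q $ j + 1 \<longleftrightarrow> p $ i = p $ j + 1))"
proof -
  have "sgn (q $ i - q $ j) = sgn (p $ i - p $ j) \<longleftrightarrow>
      (q $ i \<le> q $ j \<longleftrightarrow> p $ i \<le> p $ j) \<and> (q $ j \<le> q $ i \<longleftrightarrow> p $ j \<le> p $ i)" for i j
    by (auto simp: sgn_if)
  moreover have "sgn (q $ i - q $ j - 1) = sgn (p $ i - p $ j - 1) \<longleftrightarrow>
      (q $ i < q $ j + 1 \<longleftrightarrow> p $ i < p $ j + 1) \<and> (q $ i = q $ j + 1 \<longleftrightarrow> p $ i = p $ j + 1)" for i j
    by (auto simp: sgn_if)
  moreover have "(\<forall>i j. q $ i \<le> q $ j \<longleftrightarrow> p $ i \<le> p $ j) \<longleftrightarrow> (\<forall>i j. i < j \<longrightarrow>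
      (q $ i \<le> q $ j \<longleftrightarrow> p $ i \<le> p $ j) \<and> (q $ j \<le> q $ i \<longleftrightarrow> p $ j \<le> p $ i))"
    (is "?all \<longleftrightarrow> ?less")
  proof
    assume ?less
    show ?all
    proof (intro allI)
      fix i j
      show "q $ i \<le> q $ j \<longleftrightarrow> p $ i \<le> p $ j"
        using \<open>?less\<close> by (cases i j rule: linorder_cases) auto
    qed
  qed blast
  ultimately show ?thesis
    unfolding sign_cell_def mem_Collect_eq ball_shi_arrangement inner_axis_diff diff_0_right
    by (simp only:) blast
qed

lemma face_conditions_iff_mem_shi_cell:
  "face_conditions T p \<Longrightarrow> face_conditions T q \<longleftrightarrow> q \<in> sign_cell shi_arrangement p"
  unfolding face_conditions_def mem_shi_cell_iff by simp

lemma
  assumes "face_conditions T p"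
  shows face_conditions_less_iff: "p $ i < p $ j \<longleftrightarrow> node_of T i \<prec>\<^sub>T node_of T j"
    and face_conditions_eq_iff: "p $ i = p $ j \<longleftrightarrow> node_of T i = node_of T j"
    and face_conditions_less_add_one_iff:
      "i < j \<Longrightarrow> p $ i < p $ j + 1 \<longleftrightarrow> node_of T i \<prec>\<^sub>T right_child (node_of T j)"
    and face_conditions_eq_add_one_iff:
      "i < j \<Longrightarrow> p $ i = p $ j + 1 \<longleftrightarrow>
        node_of T i = right_child (node_of T j) \<and> captive T (right_child (node_of T j))"
proof -
  have le_iff: "p $ i \<le> p $ j \<longleftrightarrow> node_of T i \<preceq>\<^sub>T node_of T j" for i j
    using assms by (simp add: face_conditions_def)
  show "p $ i < p $ j \<longleftrightarrow> node_of T i \<prec>\<^sub>T node_of T j"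
    using le_iff[of j i] by (simp add: not_le[symmetric] vertex.not_le[symmetric])
  show "p $ i = p $ j \<longleftrightarrow> node_of T i = node_of T j"
    unfolding order_eq_iff[of "p $ i"] vertex.order_eq_iff[of "node_of T i"] le_iff ..
qed (use assms in \<open>simp_all add: face_conditions_def\<close>)

section \<open>Ranks among the free nodes\<close>

definition free_rank :: "'a dtree \<Rightarrow> step list \<Rightarrow> nat" where
  "free_rank T v = card {u \<in> free_nodes T. u \<le> v}"

definition captive_edges :: "'a dtree \<Rightarrow> (step list \<times> step list) set" where
  "captive_edges T = {(u, right_child u) | u. captive T (right_child u)}"

lemma captive_induct [consumes 1, case_names free captive]:
  assumes "w \<in> nodes T"
    and "\<And>w. w \<in> free_nodes T \<Longrightarrow> P w"
    and "\<And>u. u \<in> nodes T \<Longrightarrow> captive T (right_child u) \<Longrightarrow> P u \<Longrightarrow> P (right_child u)"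
  shows "P w"
  using assms(1)
proof (induction "length w" arbitrary: w rule: less_induct)
  case less
  show ?case
  proof (cases "captive T w")
    case True
    then obtain u where u: "u \<in> nodes T" "w = right_child u"
      unfolding captive_def by blast
    then have "P u"
      by (intro less.hyps) (auto simp: right_child_def)
    with u True show ?thesis using assms(3) by blast
  next
    case False
    with less.prems show ?thesis
      by (intro assms(2)) (simp add: free_nodes_def)
  qed
qed

lemma finite_free_nodes: "finite (free_nodes T)"
  by (simp add: free_nodes_def finite_nodes)

lemma free_rank_le_card: "free_rank T v \<le> card (free_nodes T)"
  unfolding free_rank_def by (rule card_mono) (auto simp: finite_free_nodes)

lemma free_rank_mono: "v \<le> w \<Longrightarrow> free_rank T v \<le> free_rank T w"
  unfolding free_rank_def by (rule card_mono) (auto simp: finite_free_nodes)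

lemma free_rank_less_free:
  assumes "w \<in> free_nodes T" "v < w" shows "free_rank T v < free_rank T w"
  unfolding free_rank_def
proof (rule psubset_card_mono)
  show "{u \<in> free_nodes T. u \<le> v} \<subset> {u \<in> free_nodes T. u \<le> w}"
    using assms by (force simp: psubset_eq set_eq_iff)
qed (simp add: finite_free_nodes)

lemma free_rank_captive:
  assumes "captive T (right_child u)"
  shows "free_rank T (right_child u) = free_rank T u"
proof -
  have "v \<le> right_child u \<longleftrightarrow> v \<le> u" if "v \<in> free_nodes T" for v
    using that assms by (auto simp: free_nodes_def le_less[of v "right_child u"])
  then have "{v \<in> free_nodes T. v \<le> right_child u} = {v \<in> free_nodes T. v \<le> u}"
    by blast
  then show ?thesis by (simp add: free_rank_def)
qed

lemma card_free_rank_image: "card (free_rank T ` nodes T) = card (free_nodes T)"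
proof -
  have "free_rank T w \<in> free_rank T ` free_nodes T" if "w \<in> nodes T" for w
    using that by (induction rule: captive_induct) (simp_all add: free_rank_captive)
  then have "free_rank T ` nodes T = free_rank T ` free_nodes T"
    by (auto simp: free_nodes_def)
  moreover have "inj_on (free_rank T) (free_nodes T)"
    by (rule linorder_inj_onI') (use free_rank_less_free in fastforce)
  ultimately show ?thesis by (simp add: card_image)
qed

lemma captive_path_if_free_rank_eq:
  assumes "w \<in> nodes T" "v \<le> w" "free_rank T v = free_rank T w"
  shows "(v, w) \<in> (captive_edges T)\<^sup>*"
  using assms
proof (induction rule: captive_induct)
  case (free w)
  then have "v = w"
    using free_rank_less_free[of w T v] by (auto simp: le_less)
  then show ?case by simp
next
  case (captive u)
  show ?case
  proof (cases "v = right_child u")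
    case False
    then have "v \<le> u"
      using captive.prems(1) by (simp add: le_less[of v "right_child u"])
    then have "(v, u) \<in> (captive_edges T)\<^sup>*"
      using captive by (simp add: free_rank_captive)
    moreover have "(u, right_child u) \<in> captive_edges T"
      using captive.hyps by (auto simp: captive_edges_def)
    ultimately show ?thesis by (rule rtrancl.rtrancl_into_rtrancl)
  qed simp
qed

lemma right_child_funpow_if_captive_path:
  "(v, w) \<in> (captive_edges T)\<^sup>* \<Longrightarrow> \<exists>m. w = (right_child ^^ m) v"
proof (induction rule: rtrancl_induct)
  case base
  show ?case by (rule exI[of _ 0]) simp
next
  case (step u w)
  then obtain m where "u = (right_child ^^ m) v" by blast
  with step.hyps(2) have "w = (right_child ^^ Suc m) v"
    by (auto simp: captive_edges_def)
  then show ?case ..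
qed

lemma right_child_funpow_if_free_rank_eq:
  assumes "v \<in> nodes T" "v' \<le> v" "free_rank T v' = free_rank T v"
  obtains m where "v = (right_child ^^ m) v'"
  using right_child_funpow_if_captive_path[OF captive_path_if_free_rank_eq[OF assms]] that by blast

lemma free_rank_less_iff:
  assumes "v \<in> nodes T" "rho_dot w = rho_dot v + k"
  shows "free_rank T w < free_rank T v \<longleftrightarrow> w < (right_child ^^ k) v"
proof
  assume "free_rank T w < free_rank T v"
  then have "w < v"
    using free_rank_mono[of v w T] by force
  then show "w < (right_child ^^ k) v"
    using right_child_funpow_le[of v k] by (rule less_le_trans)
next
  assume less: "w < (right_child ^^ k) v"
  then have "w \<le> v"
    using less_right_child_funpowD[OF less] assms(2) by auto
  then have "free_rank T w \<le> free_rank T v"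
    by (rule free_rank_mono)
  moreover have "free_rank T w \<noteq> free_rank T v"
  proof
    assume "free_rank T w = free_rank T v"
    then obtain m where "v = (right_child ^^ m) w"
      using right_child_funpow_if_free_rank_eq assms(1) \<open>w \<le> v\<close> by metis
    then have "rho_dot v = rho_dot w + m" by simp
    with assms(2) \<open>v = (right_child ^^ m) w\<close> have "k = 0" "v = w" by simp_all
    with less show False by simp
  qed
  ultimately show "free_rank T w < free_rank T v" by simp
qed

lemma free_rank_eq_right_childD:
  assumes "v \<in> nodes T" "w \<in> nodes T" "rho_dot w = Suc (rho_dot v)"
    and "free_rank T v = free_rank T w"
  shows "w = right_child v \<and> captive T (right_child v)"
proof -
  have "v \<le> w"
  proof (rule ccontr)
    assume "\<not> v \<le> w"
    then obtain m where "v = (right_child ^^ m) w"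
      using right_child_funpow_if_free_rank_eq[OF assms(1)] assms(4) by (metis linear)
    with assms(3) show False by simp
  qed
  then have "(v, w) \<in> (captive_edges T)\<^sup>*"
    using assms by (intro captive_path_if_free_rank_eq)
  moreover have "v \<noteq> w"
    using assms(3) by auto
  ultimately obtain u where u: "(v, u) \<in> (captive_edges T)\<^sup>*" "(u, w) \<in> captive_edges T"
    by (metis rtranclE)
  then obtain m where "u = (right_child ^^ m) v"
    using right_child_funpow_if_captive_path by blast
  with u(2) assms(3) have "u = v"
    by (auto simp: captive_edges_def)
  with u(2) show ?thesis
    by (auto simp: captive_edges_def)
qed

section \<open>A point in the face of a tree\<close>

definition node_value :: "'a dtree \<Rightarrow> step list \<Rightarrow> real" where
  "node_value T v = rho_dot v + free_rank T v / (card (free_nodes T) + 1)"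

lemma node_value_bounds:
  "rho_dot v \<le> node_value T v" "node_value T v < rho_dot v + 1"
  using free_rank_le_card[of T v] by (simp_all add: node_value_def divide_less_eq)

lemma node_value_less_add_iff:
  assumes "v \<in> nodes T"
  shows "node_value T w < node_value T v + k \<longleftrightarrow> w \<prec>\<^sub>T (right_child ^^ k) v"
proof (cases "rho_dot w" "rho_dot v + k" rule: linorder_cases)
  case less
  then have "real (rho_dot w) + 1 \<le> rho_dot v + k" by linarith
  then have "node_value T w < node_value T v + k"
    using node_value_bounds[where T = T and v = v] node_value_bounds[where T = T and v = w]
    by linarith
  with less show ?thesis by (simp add: vertex_less_iff)
next
  case equal
  then have "node_value T w < node_value T v + k \<longleftrightarrow> free_rank T w < free_rank T v"
    by (simp add: node_value_def divide_less_cancel)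
  with equal free_rank_less_iff[OF assms equal] show ?thesis
    by (simp add: vertex_less_iff)
next
  case greater
  then have "real (rho_dot v) + k + 1 \<le> rho_dot w" by linarith
  then have "\<not> node_value T w < node_value T v + k"
    using node_value_bounds[where T = T and v = v] node_value_bounds[where T = T and v = w]
    by linarith
  with greater show ?thesis by (simp add: vertex_less_iff)
qed

lemma node_value_eq_add_one_iff:
  assumes "v \<in> nodes T" "w \<in> nodes T"
  shows "node_value T w = node_value T v + 1 \<longleftrightarrow> w = right_child v \<and> captive T (right_child v)"
proof
  assume eq: "node_value T w = node_value T v + 1"
  then have rho_dot: "rho_dot w = Suc (rho_dot v)"
    using node_value_bounds[where T = T and v = v] node_value_bounds[where T = T and v = w]
    by linarith
  with eq have "free_rank T v = free_rank T w"
    by (simp add: node_value_def)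
  with assms rho_dot show "w = right_child v \<and> captive T (right_child v)"
    by (intro free_rank_eq_right_childD)
next
  assume "w = right_child v \<and> captive T (right_child v)"
  then show "node_value T w = node_value T v + 1"
    by (auto simp: node_value_def free_rank_captive)
qed

lemma face_conditions_node_value:
  fixes T :: "'n::{finite,linorder} dtree"
  assumes "decorated T"
  shows "face_conditions T (\<chi> i. node_value T (node_of T i))"
proof -
  let ?value = "\<lambda>i. node_value T (node_of T i)"
  note nodes = node_of_in_nodes[OF assms]
  have "?value i \<le> ?value j \<longleftrightarrow> node_of T i \<preceq>\<^sub>T node_of T j" for i j
    using node_value_less_add_iff[OF nodes, of "node_of T j" i 0]
    by (simp add: not_less[symmetric] vertex.not_less[symmetric])
  moreover have "?value i < ?value j + 1 \<longleftrightarrow> node_of T i \<prec>\<^sub>T right_child (node_of T j)" for i j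
    using node_value_less_add_iff[OF nodes, of "node_of T i" j 1] by simp
  moreover have "?value i = ?value j + 1 \<longleftrightarrow>
      node_of T i = right_child (node_of T j) \<and> captive T (right_child (node_of T j))" for i j
    by (rule node_value_eq_add_one_iff[OF nodes nodes])
  ultimately show ?thesis
    by (simp add: face_conditions_def)
qed

section \<open>The dimension of the face of a tree\<close>

lemma dim_fixed_by_reindexing:
  fixes rep :: "'n::finite \<Rightarrow> 'n"
  assumes idem: "\<And>i. rep (rep i) = rep i"
  shows "dim {x :: real ^ 'n. \<forall>i. x $ rep i = x $ i} = card (range rep)" (is "dim ?S = _")
proof -
  define Z where "Z = {x :: real ^ 'n. \<forall>i. i \<notin> range rep \<longrightarrow> x $ i = 0}"
  define spread :: "real ^ 'n \<Rightarrow> real ^ 'n" where "spread x = (\<chi> i. x $ rep i)" for x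
  have "linear spread"
    by (simp add: linear_iff vec_eq_iff spread_def)
  moreover have "subspace Z"
    by (rule subspaceI) (auto simp: Z_def)
  moreover have "inj_on spread Z"
  proof (rule inj_onI)
    fix x y assume xy: "x \<in> Z" "y \<in> Z" "spread x = spread y"
    have "x $ rep i = y $ rep i" for i
      using xy(3) by (simp add: spread_def vec_eq_iff)
    with xy(1,2) have "x $ i = y $ i" for i
      by (cases "i \<in> range rep") (auto simp: Z_def)
    then show "x = y" by (simp add: vec_eq_iff)
  qed
  moreover have "spread ` Z = ?S"
  proof (intro set_eqI iffI)
    fix x assume x: "x \<in> ?S"
    define z where "z = (\<chi> i. if i \<in> range rep then x $ i else 0)"
    have "spread z = x"
      using x by (simp add: spread_def z_def vec_eq_iff)
    moreover have "z \<in> Z"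
      by (simp add: Z_def z_def)
    ultimately show "x \<in> spread ` Z" by blast
  qed (auto simp: spread_def idem)
  ultimately have "dim ?S = dim Z"
    using dim_image_eq[of spread Z] span_eq_iff[of Z, THEN iffD2] by simp
  also have "\<dots> = card (range rep)"
    unfolding Z_def dim_vec_eq[symmetric] by (rule dim_substandard_cart)
  finally show ?thesis .
qed

lemma dim_constant_on_fibres:
  fixes f :: "'n::finite \<Rightarrow> 'b"
  shows "dim {x :: real ^ 'n. \<forall>i j. f i = f j \<longrightarrow> x $ i = x $ j} = card (range f)"
proof -
  define rep where "rep i = inv f (f i)" for i
  have f_rep: "f (rep i) = f i" for i
    unfolding rep_def by (rule f_inv_into_f) simp
  have idem: "rep (rep i) = rep i" for i
    unfolding rep_def[of "rep i"] f_rep by (simp add: rep_def)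
  have "(\<forall>i j. f i = f j \<longrightarrow> x $ i = x $ j) \<longleftrightarrow> (\<forall>i. x $ rep i = x $ i)" for x :: "real ^ 'n"
    using f_rep unfolding rep_def by metis
  then have "dim {x :: real ^ 'n. \<forall>i j. f i = f j \<longrightarrow> x $ i = x $ j} = card (range rep)"
    by (simp add: dim_fixed_by_reindexing[OF idem])
  also have "range rep = inv f ` range f"
    by (auto simp: rep_def)
  also have "card \<dots> = card (range f)"
    by (simp add: card_image inj_on_inv_into)
  finally show ?thesis .
qed

lemma shi_trees_right_childE:
  fixes T :: "'n::{finite,linorder} dtree"
  assumes "T \<in> shi_trees" "right_child v \<in> nodes T"
  obtains i j where "i < j" "node_of T i = right_child v" "node_of T j = v"
  using assms shi_type_iff[of T] that by (auto simp: shi_trees_def)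

lemma flat_directions_constant_on_captive_path:
  fixes T :: "'n::{finite,linorder} dtree"
  assumes T: "T \<in> shi_trees" and p: "face_conditions T p"
    and x: "x \<in> flat_directions shi_arrangement p"
    and "(node_of T j, w) \<in> (captive_edges T)\<^sup>*"
  shows "node_of T i = w \<Longrightarrow> x $ i = x $ j"
proof -
  have same_node: "x $ i = x $ j" if "node_of T i = node_of T j" for i j
    using that x face_conditions_eq_iff[OF p, of i j]
    by (cases i j rule: linorder_cases) (auto simp: mem_flat_directions_shi_iff)
  show "node_of T i = w \<Longrightarrow> x $ i = x $ j"
    using assms(4)
  proof (induction arbitrary: i rule: rtrancl_induct)
    case base
    then show ?case by (rule same_node)
  next
    case (step u w)
    then have w: "w = right_child u" "captive T (right_child u)"
      by (auto simp: captive_edges_def)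
    then have "right_child u \<in> nodes T"
      by (simp add: captive_def)
    then obtain a b where ab: "a < b" "node_of T a = right_child u" "node_of T b = u"
      by (rule shi_trees_right_childE[OF T])
    then have "p $ a = p $ b + 1"
      using w face_conditions_eq_add_one_iff[OF p] by simp
    then have "x $ a = x $ b"
      using x ab(1) by (simp add: mem_flat_directions_shi_iff)
    moreover have "x $ i = x $ a"
      using step.prems w ab(2) by (intro same_node) simp
    ultimately show ?case
      using step.IH[OF ab(3)] by simp
  qed
qed

lemma flat_directions_face:
  fixes T :: "'n::{finite,linorder} dtree"
  assumes T: "T \<in> shi_trees" and p: "face_conditions T p"
  shows "flat_directions shi_arrangement p =
    {x. \<forall>i j. free_rank T (node_of T i) = free_rank T (node_of T j) \<longrightarrow> x $ i = x $ j}"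
proof (intro set_eqI iffI CollectI allI impI)
  fix x :: "(real, 'n) vec" and i j
  assume x: "x \<in> flat_directions shi_arrangement p"
    and eq: "free_rank T (node_of T i) = free_rank T (node_of T j)"
  have "node_of T k \<in> nodes T" for k
    using T by (simp add: shi_trees_def node_of_in_nodes)
  then consider "(node_of T i, node_of T j) \<in> (captive_edges T)\<^sup>*"
    | "(node_of T j, node_of T i) \<in> (captive_edges T)\<^sup>*"
    using captive_path_if_free_rank_eq eq by (metis linear)
  then show "x $ i = x $ j"
    using flat_directions_constant_on_captive_path[OF T p x] by cases metis+
next
  fix x :: "(real, 'n) vec"
  assume "x \<in> {x. \<forall>i j. free_rank T (node_of T i) = free_rank T (node_of T j) \<longrightarrow> x $ i = x $ j}"
  moreover have "free_rank T (node_of T i) = free_rank T (node_of T j)"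
    if "i < j" "p $ i = p $ j \<or> p $ i = p $ j + 1" for i j
    using that face_conditions_eq_iff[OF p, of i j] face_conditions_eq_add_one_iff[OF p, of i j]
    by (auto simp: free_rank_captive)
  ultimately show "x \<in> flat_directions shi_arrangement p"
    unfolding mem_flat_directions_shi_iff by blast
qed

lemma aff_dim_shi_cell:
  fixes T :: "'n::{finite,linorder} dtree"
  assumes T: "T \<in> shi_trees" and p: "face_conditions T p"
  shows "aff_dim (sign_cell shi_arrangement p) = int (card (free_nodes T))"
proof -
  have "aff_dim (sign_cell shi_arrangement p) = int (dim (flat_directions shi_arrangement p))"
    by (rule aff_dim_sign_cell[OF finite_shi_arrangement])
  also have "\<dots> = int (card (range (\<lambda>i. free_rank T (node_of T i))))"
    by (simp add: flat_directions_face[OF T p] dim_constant_on_fibres)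
  also have "range (\<lambda>i. free_rank T (node_of T i)) = free_rank T ` nodes T"
    using T by (simp add: shi_trees_def nodes_eq_range_node_of image_image)
  finally show ?thesis by (simp add: card_free_rank_image)
qed

section \<open>The greedy placement\<close>

definition forces_descent :: "(real, 'n::{finite,linorder}) vec \<Rightarrow> 'n \<Rightarrow> 'n \<Rightarrow> bool" where
  "forces_descent p j i \<longleftrightarrow> p $ j + 1 \<le> p $ i \<and> (\<exists>a b. a < b \<and> p $ a = p $ i \<and> p $ b = p $ j)"

lemma forces_descent_less: "forces_descent p j i \<Longrightarrow> p $ j < p $ i"
  by (simp add: forces_descent_def)

definition greedy_candidates ::
    "(real, 'n::{finite,linorder}) vec \<Rightarrow> ('n \<Rightarrow> step list) \<Rightarrow> 'n \<Rightarrow> step list set" where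
  "greedy_candidates p w i = insert []
     ((\<lambda>j. left_child (w j)) ` {j. p $ j < p $ i} \<union>
      (\<lambda>j. right_child (w j)) ` {j. forces_descent p j i})"

lemma finite_greedy_candidates [simp]: "finite (greedy_candidates p w i)"
  and greedy_candidates_nonempty [simp]: "greedy_candidates p w i \<noteq> {}"
  by (simp_all add: greedy_candidates_def)

lemma greedy_candidates_cong [fundef_cong]:
  assumes "p = q" "i = j" "\<And>k. q $ k < q $ j \<Longrightarrow> w k = w' k"
  shows "greedy_candidates p w i = greedy_candidates q w' j"
  unfolding greedy_candidates_def using assms
  by (simp add: forces_descent_less cong: image_cong_simp)

function greedy_vertex :: "(real, 'n::{finite,linorder}) vec \<Rightarrow> 'n \<Rightarrow> step list" where
  "greedy_vertex p i = vertex.Max (greedy_candidates p (greedy_vertex p) i)"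
  by auto
termination
  by (relation "Wellfounded.measure (\<lambda>(p, i). card {j. p $ j < p $ i})")
    (auto intro!: psubset_card_mono)

declare greedy_vertex.simps [simp del]

lemma greedy_vertex_cases [case_names Nil left_child right_child]:
  obtains "greedy_vertex p i = []"
  | j where "p $ j < p $ i" "greedy_vertex p i = left_child (greedy_vertex p j)"
  | j where "forces_descent p j i" "greedy_vertex p i = right_child (greedy_vertex p j)"
proof -
  have "greedy_vertex p i \<in> greedy_candidates p (greedy_vertex p) i"
    by (subst greedy_vertex.simps) (rule vertex.Max_in; simp)
  then show thesis using that by (auto simp: greedy_candidates_def)
qed

lemma left_child_greedy_vertex_le:
  "p $ j < p $ i \<Longrightarrow> left_child (greedy_vertex p j) \<preceq>\<^sub>T greedy_vertex p i"
  by (subst (2) greedy_vertex.simps) (rule vertex.Max_ge; simp add: greedy_candidates_def)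

lemma right_child_greedy_vertex_le:
  "forces_descent p j i \<Longrightarrow> right_child (greedy_vertex p j) \<preceq>\<^sub>T greedy_vertex p i"
  by (subst (2) greedy_vertex.simps) (rule vertex.Max_ge; simp add: greedy_candidates_def)

lemma greedy_vertex_cong: "p $ i = p $ j \<Longrightarrow> greedy_vertex p i = greedy_vertex p j"
  by (simp add: greedy_vertex.simps[of p i] greedy_vertex.simps[of p j] greedy_candidates_def
      forces_descent_def)

lemma greedy_vertex_strict_mono:
  assumes "p $ j < p $ i" shows "greedy_vertex p j \<prec>\<^sub>T greedy_vertex p i"
proof -
  have "greedy_vertex p j \<prec>\<^sub>T left_child (greedy_vertex p j)" by simp
  also have "\<dots> \<preceq>\<^sub>T greedy_vertex p i"
    using assms by (rule left_child_greedy_vertex_le)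
  finally show ?thesis .
qed

lemma greedy_vertex_less_iff: "greedy_vertex p j \<prec>\<^sub>T greedy_vertex p i \<longleftrightarrow> p $ j < p $ i"
  and greedy_vertex_eq_iff: "greedy_vertex p j = greedy_vertex p i \<longleftrightarrow> p $ j = p $ i"
  using greedy_vertex_strict_mono[of p i j] greedy_vertex_strict_mono[of p j i]
    greedy_vertex_cong[of p i j]
  by (cases "p $ i" "p $ j" rule: linorder_cases; auto)+

lemma forces_descent_if_right_child:
  assumes "greedy_vertex p i = right_child (greedy_vertex p j)"
  shows "forces_descent p j i"
proof (cases p i rule: greedy_vertex_cases)
  case (right_child k)
  with assms have "p $ j = p $ k" by (simp add: greedy_vertex_eq_iff)
  with right_child(1) show ?thesis by (simp add: forces_descent_def)
qed (use assms in simp_all)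

lemma add_one_less_if_right_child_less:
  "right_child (greedy_vertex p j) \<prec>\<^sub>T greedy_vertex p i \<Longrightarrow> p $ j + 1 < p $ i"
proof (induction p i rule: greedy_vertex.induct[case_names less])
  case (less p i)
  show ?case
  proof (cases p i rule: greedy_vertex_cases)
    case Nil
    with less.prems show ?thesis by simp
  next
    case (left_child k)
    with less.prems have "right_child (greedy_vertex p j) \<preceq>\<^sub>T greedy_vertex p k" by simp
    then have "p $ j + 1 \<le> p $ k"
      using less.IH(1)[of k] left_child(1) forces_descent_if_right_child[of p k j]
      by (auto simp: vertex.le_less forces_descent_def)
    with left_child show ?thesis by simp
  next
    case (right_child k)
    with less.prems have "p $ j < p $ k" by (simp add: greedy_vertex_less_iff)
    with right_child show ?thesis by (simp add: forces_descent_def)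
  qed
qed

lemma right_child_greedy_vertex_le_iff:
  assumes "i < j"
  shows "right_child (greedy_vertex p j) \<preceq>\<^sub>T greedy_vertex p i \<longleftrightarrow> p $ j + 1 \<le> p $ i"
proof
  assume "right_child (greedy_vertex p j) \<preceq>\<^sub>T greedy_vertex p i"
  then show "p $ j + 1 \<le> p $ i"
    using add_one_less_if_right_child_less[of p j i] forces_descent_if_right_child[of p i j]
    by (auto simp: vertex.le_less forces_descent_def)
next
  assume "p $ j + 1 \<le> p $ i"
  with assms show "right_child (greedy_vertex p j) \<preceq>\<^sub>T greedy_vertex p i"
    by (intro right_child_greedy_vertex_le) (auto simp: forces_descent_def)
qed

lemma greedy_vertex_eq_right_child:
  assumes "i < j" "p $ i = p $ j + 1"
  shows "greedy_vertex p i = right_child (greedy_vertex p j)"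
  using assms add_one_less_if_right_child_less[of p j i] right_child_greedy_vertex_le_iff[of i j p]
  by (auto simp: vertex.le_less)

lemma range_greedy_vertex_snocD:
  assumes "v @ [s] \<in> range (greedy_vertex p)"
  shows "v \<in> range (greedy_vertex p)"
proof -
  obtain i where "greedy_vertex p i = v @ [s]"
    using assms by force
  then show ?thesis
    by (cases p i rule: greedy_vertex_cases) (auto simp: left_child_def right_child_def)
qed

section \<open>Uniqueness of the tree\<close>

lemma face_conditions_right_child_le:
  assumes p: "face_conditions T p" and "forces_descent p j i"
  shows "right_child (node_of T j) \<preceq>\<^sub>T node_of T i"
proof -
  obtain a b where ab: "a < b" "p $ a = p $ i" "p $ b = p $ j" and "p $ j + 1 \<le> p $ i"
    using assms(2) by (auto simp: forces_descent_def)
  then have "right_child (node_of T b) \<preceq>\<^sub>T node_of T a"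
    using face_conditions_less_add_one_iff[OF p ab(1)] by (simp add: vertex.not_less[symmetric])
  then show ?thesis
    using ab by (simp add: face_conditions_eq_iff[OF p])
qed

lemma face_conditions_node_of_cases:
  fixes T :: "'n::{finite,linorder} dtree"
  assumes T: "T \<in> shi_trees" and p: "face_conditions T p"
  obtains "node_of T i = []"
  | j where "p $ j < p $ i" "node_of T i = left_child (node_of T j)"
  | j where "forces_descent p j i" "node_of T i = right_child (node_of T j)"
proof -
  have i: "node_of T i \<in> nodes T" and nodes: "nodes T = range (node_of T)"
    using T by (simp_all add: shi_trees_def node_of_in_nodes nodes_eq_range_node_of)
  show thesis
  proof (cases "node_of T i" rule: vertex_cases)
    case Nil
    then show thesis by (rule that(1))
  next
    case (left_child u)
    with i have "u \<in> nodes T"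
      using nodes_left_childD by simp
    then obtain j where "u = node_of T j"
      using nodes by blast
    with left_child show thesis
      by (intro that(2)[of j]) (simp_all add: face_conditions_less_iff[OF p])
  next
    case (right_child u)
    with i obtain a b where ab: "a < b" "node_of T a = right_child u" "node_of T b = u"
      using shi_trees_right_childE[OF T] by metis
    then have "p $ a = p $ i"
      using right_child by (simp add: face_conditions_eq_iff[OF p])
    moreover have "\<not> p $ a < p $ b + 1"
      using ab by (simp add: face_conditions_less_add_one_iff[OF p])
    ultimately have "forces_descent p b i"
      using ab(1) by (auto simp: forces_descent_def)
    with right_child ab(3) show thesis
      by (intro that(3)[of b]) simp_all
  qed
qed

lemma node_of_eq_greedy_vertex:
  fixes T :: "'n::{finite,linorder} dtree"
  assumes "T \<in> shi_trees" "face_conditions T p"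
  shows "node_of T i = greedy_vertex p i"
  using assms
proof (induction p i rule: greedy_vertex.induct[case_names less])
  case (less p i)
  have "node_of T i \<in> greedy_candidates p (node_of T) i"
    by (rule face_conditions_node_of_cases[OF less.prems, of i]) (auto simp: greedy_candidates_def)
  moreover have "v \<preceq>\<^sub>T node_of T i" if "v \<in> greedy_candidates p (node_of T) i" for v
    using that face_conditions_right_child_le[OF less.prems(2)]
    by (auto simp: greedy_candidates_def face_conditions_less_iff[OF less.prems(2)])
  ultimately have "node_of T i = vertex.Max (greedy_candidates p (node_of T) i)"
    by (intro vertex.Max_eqI[symmetric]) auto
  also have "greedy_candidates p (node_of T) i = greedy_candidates p (greedy_vertex p) i"
    using less by (intro greedy_candidates_cong) simp_all
  also have "vertex.Max \<dots> = greedy_vertex p i"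
    by (simp add: greedy_vertex.simps[of p i])
  finally show ?case .
qed

lemma shi_tree_unique:
  fixes T T' :: "'n::{finite,linorder} dtree"
  assumes T: "T \<in> shi_trees" and T': "T' \<in> shi_trees"
    and p: "face_conditions T p" and p': "face_conditions T' p"
  shows "T = T'"
proof (rule decorated_eqI)
  show "decorated T" "decorated T'"
    using T T' by (simp_all add: shi_trees_def)
  show same: "node_of T = node_of T'"
    using node_of_eq_greedy_vertex[OF T p] node_of_eq_greedy_vertex[OF T' p'] by auto
  show "captive T (right_child v) \<longleftrightarrow> captive T' (right_child v)" if "right_child v \<in> nodes T" for v
  proof -
    obtain a b where ab: "a < b" "node_of T a = right_child v" "node_of T b = v"
      by (rule shi_trees_right_childE[OF T \<open>right_child v \<in> nodes T\<close>])
    then have "captive T (right_child v) \<longleftrightarrow> p $ a = p $ b + 1"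
      by (simp add: face_conditions_eq_add_one_iff[OF p])
    also have "\<dots> \<longleftrightarrow> captive T' (right_child v)"
      using ab by (simp add: face_conditions_eq_add_one_iff[OF p'] same)
    finally show ?thesis .
  qed
qed

section \<open>Existence of the tree\<close>

lemma shi_type_if_greedy:
  assumes "decorated T" and node_of: "node_of T = greedy_vertex p"
  shows "shi_type T"
  unfolding shi_type_iff[OF assms(1)]
proof (intro allI impI)
  fix v assume "right_child v \<in> nodes T"
  then obtain i where i: "greedy_vertex p i = right_child v"
    using nodes_eq_range_node_of[OF assms(1)] node_of by force
  then obtain j where "greedy_vertex p j = v" "forces_descent p j i"
    by (cases p i rule: greedy_vertex_cases) auto
  with i show "\<exists>i j. i < j \<and> node_of T i = right_child v \<and> node_of T j = v"
    unfolding node_of forces_descent_def by (metis greedy_vertex_cong)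
qed

definition greedy_captives :: "(real, 'n::{finite,linorder}) vec \<Rightarrow> step list set" where
  "greedy_captives p = {greedy_vertex p i | i j.
     greedy_vertex p i = right_child (greedy_vertex p j) \<and> p $ i = p $ j + 1}"

lemma face_conditions_if_greedy:
  assumes node_of: "node_of T = greedy_vertex p"
    and captive: "\<And>v. captive T v \<longleftrightarrow> v \<in> greedy_captives p"
  shows "face_conditions T p"
  unfolding face_conditions_def node_of captive
proof (intro conjI allI impI)
  let ?w = "greedy_vertex p"
  fix i j
  show "p $ i \<le> p $ j \<longleftrightarrow> ?w i \<preceq>\<^sub>T ?w j"
    by (simp add: not_less[symmetric] vertex.not_less[symmetric] greedy_vertex_less_iff)
  assume "i < j"
  then show "p $ i < p $ j + 1 \<longleftrightarrow> ?w i \<prec>\<^sub>T right_child (?w j)"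
    by (simp add: not_le[symmetric] vertex.not_le[symmetric] right_child_greedy_vertex_le_iff)
  show "p $ i = p $ j + 1 \<longleftrightarrow> ?w i = right_child (?w j) \<and> right_child (?w j) \<in> greedy_captives p"
  proof
    assume "p $ i = p $ j + 1"
    with greedy_vertex_eq_right_child[OF \<open>i < j\<close> this]
    show "?w i = right_child (?w j) \<and> right_child (?w j) \<in> greedy_captives p"
      unfolding greedy_captives_def by force
  next
    assume "?w i = right_child (?w j) \<and> right_child (?w j) \<in> greedy_captives p"
    then obtain i' j' where "?w i = ?w i'" "?w j = ?w j'" "p $ i' = p $ j' + 1"
      unfolding greedy_captives_def mem_Collect_eq by (metis right_child_inject)
    then show "p $ i = p $ j + 1"
      by (simp add: greedy_vertex_eq_iff)
  qed
qed

lemma shi_tree_exists: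
  fixes p :: "(real, 'n::{finite,linorder}) vec"
  obtains T where "T \<in> shi_trees" "face_conditions T p"
proof -
  obtain T where decorated: "decorated T" and node_of: "node_of T = greedy_vertex p"
    and captive: "\<And>v. captive T v \<longleftrightarrow> v \<in> greedy_captives p"
    by (rule decorated_exists[of "greedy_vertex p" "greedy_captives p"])
      (auto simp: greedy_captives_def intro: range_greedy_vertex_snocD)
  show thesis
  proof (rule that)
    show "T \<in> shi_trees"
      using decorated shi_type_if_greedy[OF decorated node_of] by (simp add: shi_trees_def)
    show "face_conditions T p"
      using node_of captive by (rule face_conditions_if_greedy)
  qed
qed

section \<open>The correspondence\<close>

lemma ex1_face:
  assumes "face_conditions T p"
  shows "\<exists>!F. F \<in> arrangement_faces shi_arrangement \<and> (\<forall>q. q \<in> F \<longleftrightarrow> face_conditions T q)"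
  using face_conditions_iff_mem_shi_cell[OF assms]
  by (intro ex1I[of _ "sign_cell shi_arrangement p"]) (auto simp: arrangement_faces_eq_sign_cells)

lemma Psi_eq_sign_cell:
  assumes "face_conditions T p" shows "Psi T = sign_cell shi_arrangement p"
  unfolding Psi_def using face_conditions_iff_mem_shi_cell[OF assms]
  by (intro the1_equality[OF ex1_face[OF assms]]) (simp add: arrangement_faces_eq_sign_cells)

lemma shi_trees_face_point:
  assumes "T \<in> shi_trees" obtains p where "face_conditions T p"
  using assms face_conditions_node_value by (auto simp: shi_trees_def)

lemma mem_Psi_iff:
  assumes "T \<in> shi_trees" shows "q \<in> Psi T \<longleftrightarrow> face_conditions T q"
proof -
  obtain p where p: "face_conditions T p"
    using assms by (rule shi_trees_face_point)
  then show ?thesis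
    by (simp add: Psi_eq_sign_cell[OF p] face_conditions_iff_mem_shi_cell[OF p])
qed

lemma bij_betw_Psi:
  "bij_betw Psi (shi_trees :: 'n::{finite,linorder} dtree set) (arrangement_faces shi_arrangement)"
proof (rule bij_betw_imageI)
  show "inj_on Psi (shi_trees :: 'n dtree set)"
  proof (rule inj_onI)
    fix T T' :: "'n dtree"
    assume T: "T \<in> shi_trees" and T': "T' \<in> shi_trees" and eq: "Psi T = Psi T'"
    obtain p where p: "face_conditions T p"
      using T by (rule shi_trees_face_point)
    then have "face_conditions T' p"
      using eq mem_Psi_iff[OF T] mem_Psi_iff[OF T'] by blast
    with T T' p show "T = T'" by (rule shi_tree_unique)
  qed
  show "Psi ` (shi_trees :: 'n dtree set) = arrangement_faces shi_arrangement"
  proof (intro set_eqI iffI)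
    fix F :: "(real, 'n) vec set" assume "F \<in> Psi ` shi_trees"
    then show "F \<in> arrangement_faces shi_arrangement"
      by (auto simp: arrangement_faces_eq_sign_cells Psi_eq_sign_cell elim!: shi_trees_face_point)
  next
    fix F :: "(real, 'n) vec set" assume "F \<in> arrangement_faces shi_arrangement"
    then obtain p where F: "F = sign_cell shi_arrangement p"
      by (auto simp: arrangement_faces_eq_sign_cells)
    obtain T where "T \<in> shi_trees" "face_conditions T p"
      by (rule shi_tree_exists)
    with F show "F \<in> Psi ` shi_trees"
      using Psi_eq_sign_cell by blast
  qed
qed

theorem theorem2p19:
  shows "(\<forall>T \<in> (shi_trees :: 'n::{finite,linorder} dtree set).
            \<exists>!F. F \<in> arrangement_faces shi_arrangement \<and> (\<forall>p. p \<in> F \<longleftrightarrow> face_conditions T p)) \<and>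
         bij_betw Psi (shi_trees :: 'n dtree set) (arrangement_faces shi_arrangement) \<and>
         (\<forall>T \<in> (shi_trees :: 'n dtree set). \<forall>k::nat.
            card (free_nodes T) = k \<longleftrightarrow> aff_dim (Psi T) = int k)"
proof (intro conjI ballI allI)
  fix T :: "'n dtree" assume T: "T \<in> shi_trees"
  then obtain p where p: "face_conditions T p" by (rule shi_trees_face_point)
  then show "\<exists>!F. F \<in> arrangement_faces shi_arrangement \<and> (\<forall>p. p \<in> F \<longleftrightarrow> face_conditions T p)"
    by (rule ex1_face)
  have "aff_dim (Psi T) = int (card (free_nodes T))"
    using aff_dim_shi_cell[OF T p] Psi_eq_sign_cell[OF p] by simp
  then show "card (free_nodes T) = k \<longleftrightarrow> aff_dim (Psi T) = int k" for k by simp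
qed (rule bij_betw_Psi)

end
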